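(* Let $(S,+)$ be an abelian semigroup and let $\mathbb{F}$ be a nonempty subset of $\mathbb{N}$. (1) The intersection of any family of $\mathbb{F}$-convex subsets of $S$ is $\mathbb{F}$-convex, and the union of any chain (with respect to inclusion) of $\mathbb{F}$-convex subsets of $S$ is $\mathbb{F}$-convex. (2) The union of any chain of $\mathbb{F}$-konvex subsets of $S$ is $\mathbb{F}$-konvex. (3) The family of $\mathbb{F}$-konvex sets is not closed under the intersection in general; that is, there exist an abelian semigroup $S$, a nonempty $\mathbb{F}\subseteq\mathbb{N}$ and $\mathbb{F}$-konvex sets $A,B\subseteq S$ such that $A\cap B$ is not $\mathbb{F}$-konvex. (4) The intersection of an $\mathbb{F}$-convex subset and an $\mathbb{F}$-konvex subset of $S$ is always $\mathbb{F}$-konvex. In particular, if $S$ is $\mathbb{F}$-konvex, then every $\mathbb{F}$-convex subset of $S$ is also $\mathbb{F}$-konvex.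
   Context: $\mathbb{N}$ denotes the set of positive integers, and an abelian semigroup is a set with a commutative associative operation $+$. For $n\in\mathbb{N}$ and $x\in S$, $nx:=x+\cdots+x$ ($n$ summands). For $A\subseteq S$ and $n\in\mathbb{N}$ put $nA:=\{nx\mid x\in A\}$, $n^{-1}A:=\{x\in S\mid nx\in A\}$, $[n]A:=\{x_1+\cdots+x_n\mid x_1,\ldots,x_n\in A\}$. A set $A\subseteq S$ is $n$-convex if $n^{-1}([n]A)\subseteq A$, and $n$-konvex if $[n]A\subseteq nA$. For a nonempty $\mathbb{F}\subseteq\mathbb{N}$, $A$ is $\mathbb{F}$-convex (respectively $\mathbb{F}$-konvex) if it is $n$-convex (respectively $n$-konvex) for all $n\in\mathbb{F}$. *)

theory Defs
  imports Main
begin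

locale abelian_semigroup =
  fixes S :: "'a set" and add :: "'a \<Rightarrow> 'a \<Rightarrow> 'a" (infixl "\<oplus>" 65)
  assumes closed: "x \<in> S \<Longrightarrow> y \<in> S \<Longrightarrow> x \<oplus> y \<in> S"
    and assoc: "x \<in> S \<Longrightarrow> y \<in> S \<Longrightarrow> z \<in> S \<Longrightarrow> (x \<oplus> y) \<oplus> z = x \<oplus> (y \<oplus> z)"
    and commute: "x \<in> S \<Longrightarrow> y \<in> S \<Longrightarrow> x \<oplus> y = y \<oplus> x"

text \<open>There is no neutral element, so the sum \<open>x 1 \<oplus> \<dots> \<oplus> x n\<close> is specified only for
  \<open>n \<ge> 1\<close>; the value at \<open>0\<close> is unspecified and every statement uses only positive indices.\<close>

fun sg_sum :: "('a \<Rightarrow> 'a \<Rightarrow> 'a) \<Rightarrow> (nat \<Rightarrow> 'a) \<Rightarrow> nat \<Rightarrow> 'a" where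
  "sg_sum add x (Suc 0) = x 1"
| "sg_sum add x (Suc (Suc n)) = add (sg_sum add x (Suc n)) (x (Suc (Suc n)))"

definition mult :: "('a \<Rightarrow> 'a \<Rightarrow> 'a) \<Rightarrow> nat \<Rightarrow> 'a \<Rightarrow> 'a" where
  "mult add n x = sg_sum add (\<lambda>_. x) n"

definition mult_image :: "('a \<Rightarrow> 'a \<Rightarrow> 'a) \<Rightarrow> nat \<Rightarrow> 'a set \<Rightarrow> 'a set" where
  "mult_image add n A = {mult add n x | x. x \<in> A}"

definition mult_preimage :: "'a set \<Rightarrow> ('a \<Rightarrow> 'a \<Rightarrow> 'a) \<Rightarrow> nat \<Rightarrow> 'a set \<Rightarrow> 'a set" where
  "mult_preimage S add n A = {x \<in> S. mult add n x \<in> A}"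

definition sumset :: "('a \<Rightarrow> 'a \<Rightarrow> 'a) \<Rightarrow> nat \<Rightarrow> 'a set \<Rightarrow> 'a set" where
  "sumset add n A = {sg_sum add x n | x. \<forall>i\<in>{1..n}. x i \<in> A}"

definition n_convex :: "'a set \<Rightarrow> ('a \<Rightarrow> 'a \<Rightarrow> 'a) \<Rightarrow> nat \<Rightarrow> 'a set \<Rightarrow> bool" where
  "n_convex S add n A \<longleftrightarrow> A \<subseteq> S \<and> mult_preimage S add n (sumset add n A) \<subseteq> A"

definition n_konvex :: "'a set \<Rightarrow> ('a \<Rightarrow> 'a \<Rightarrow> 'a) \<Rightarrow> nat \<Rightarrow> 'a set \<Rightarrow> bool" where
  "n_konvex S add n A \<longleftrightarrow> A \<subseteq> S \<and> sumset add n A \<subseteq> mult_image add n A"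

definition F_convex :: "'a set \<Rightarrow> ('a \<Rightarrow> 'a \<Rightarrow> 'a) \<Rightarrow> nat set \<Rightarrow> 'a set \<Rightarrow> bool" where
  "F_convex S add F A \<longleftrightarrow> (\<forall>n\<in>F. n_convex S add n A)"

definition F_konvex :: "'a set \<Rightarrow> ('a \<Rightarrow> 'a \<Rightarrow> 'a) \<Rightarrow> nat set \<Rightarrow> 'a set \<Rightarrow> bool" where
  "F_konvex S add F A \<longleftrightarrow> (\<forall>n\<in>F. n_konvex S add n A)"

end

theory Submission
  imports Defs
begin

text \<open>Two observations carry the closure properties.  A union of a chain behaves well because
  membership of a point in \<^term>\<open>sumset add n A\<close> has finite character: it is witnessed by \<open>n\<close>
  summands, and finitely many points of the union of a chain already lie in one member
  (\<open>sumset_Union_chainE\<close>); convexity or konvexity of that member then applies.  Intersections of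
  convex sets are convex because \<^term>\<open>sumset add n A\<close> is monotone in \<open>A\<close>.

  Konvexity is different.  It asks that an \<open>n\<close>-fold sum of points of \<open>A\<close> have \<^emph>\<open>some\<close> \<open>n\<close>-th part
  in \<open>A\<close>.  As \<open>n\<close>-th parts need not be unique, two konvex sets may rely on different ones, both
  lost in the intersection.  The semigroup \<open>square_plus\<close> below realises this: \<open>2 + 3\<close> has halves
  \<open>0\<close> and \<open>1\<close>, but neither \<open>2\<close> nor \<open>3\<close> is one.  A convex set, on the other hand, contains every
  \<open>n\<close>-th part of a sum of its points, in particular the one that the konvex set supplies; hence
  the mixed intersection is konvex.\<close>

lemma sumset_mono: "A \<subseteq> B \<Longrightarrow> sumset add n A \<subseteq> sumset add n B"
  unfolding sumset_def by blast

lemma mult_image_mono: "A \<subseteq> B \<Longrightarrow> mult_image add n A \<subseteq> mult_image add n B"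
  unfolding mult_image_def by blast

lemma mult_preimage_mono: "A \<subseteq> B \<Longrightarrow> mult_preimage S add n A \<subseteq> mult_preimage S add n B"
  unfolding mult_preimage_def by blast

text \<open>The bound \<open>n \<ge> 1\<close> makes the chain nonempty as soon as its union has an \<open>n\<close>-fold sum: with no
  summands at all there would be no member of the chain to choose.\<close>

lemma sumset_Union_chainE:
  assumes "chain_subset \<C>" and "n \<ge> 1" and "s \<in> sumset add n (\<Union>\<C>)"
  obtains A where "A \<in> \<C>" and "s \<in> sumset add n A"
proof -
  obtain x where s: "s = sg_sum add x n" and x: "\<forall>i\<in>{1..n}. x i \<in> \<Union>\<C>"
    using assms(3) unfolding sumset_def by blast
  have "x 1 \<in> \<Union>\<C>"
    using x \<open>n \<ge> 1\<close> by simp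
  then have "\<C> \<noteq> {}"
    by blast
  moreover have "finite (x ` {1..n})" and "x ` {1..n} \<subseteq> \<Union>\<C>"
    using x by auto
  moreover have "subset.chain UNIV \<C>"
    using assms(1) by (simp add: chain_subset_alt_def)
  ultimately obtain A where "A \<in> \<C>" and "x ` {1..n} \<subseteq> A"
    by (meson finite_subset_Union_chain)
  then show thesis
    using that s unfolding sumset_def by blast
qed

lemma n_convex_Inter:
  assumes "\<And>A. A \<in> \<A> \<Longrightarrow> n_convex S add n A"
  shows "n_convex S add n (S \<inter> \<Inter>\<A>)"
proof -
  have "mult_preimage S add n (sumset add n (S \<inter> \<Inter>\<A>)) \<subseteq> A" if "A \<in> \<A>" for A
  proof -
    have "S \<inter> \<Inter>\<A> \<subseteq> A"
      using that by blast
    then have "mult_preimage S add n (sumset add n (S \<inter> \<Inter>\<A>))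
        \<subseteq> mult_preimage S add n (sumset add n A)"
      by (intro mult_preimage_mono sumset_mono)
    also have "\<dots> \<subseteq> A"
      using assms[OF that] by (simp add: n_convex_def)
    finally show ?thesis .
  qed
  moreover have "mult_preimage S add n (sumset add n (S \<inter> \<Inter>\<A>)) \<subseteq> S"
    unfolding mult_preimage_def by blast
  ultimately show ?thesis
    unfolding n_convex_def by blast
qed

lemma n_convex_Union_chain:
  assumes "chain_subset \<C>" and "n \<ge> 1" and convex: "\<And>A. A \<in> \<C> \<Longrightarrow> n_convex S add n A"
  shows "n_convex S add n (\<Union>\<C>)"
  unfolding n_convex_def
proof (intro conjI subsetI)
  show "y \<in> S" if "y \<in> \<Union>\<C>" for y
    using that convex unfolding n_convex_def by blast
next
  fix y assume "y \<in> mult_preimage S add n (sumset add n (\<Union>\<C>))"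
  then have "y \<in> S" and "mult add n y \<in> sumset add n (\<Union>\<C>)"
    by (simp_all add: mult_preimage_def)
  then obtain A where "A \<in> \<C>" and "mult add n y \<in> sumset add n A"
    using sumset_Union_chainE[OF assms(1,2)] by blast
  with \<open>y \<in> S\<close> show "y \<in> \<Union>\<C>"
    using convex unfolding n_convex_def mult_preimage_def by blast
qed

lemma n_konvex_Union_chain:
  assumes "chain_subset \<C>" and "n \<ge> 1" and konvex: "\<And>A. A \<in> \<C> \<Longrightarrow> n_konvex S add n A"
  shows "n_konvex S add n (\<Union>\<C>)"
  unfolding n_konvex_def
proof (intro conjI subsetI)
  show "y \<in> S" if "y \<in> \<Union>\<C>" for y
    using that konvex unfolding n_konvex_def by blast
next
  fix s assume "s \<in> sumset add n (\<Union>\<C>)"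
  then obtain A where "A \<in> \<C>" and "s \<in> sumset add n A"
    using sumset_Union_chainE[OF assms(1,2)] by blast
  then have "s \<in> mult_image add n A"
    using konvex unfolding n_konvex_def by blast
  then show "s \<in> mult_image add n (\<Union>\<C>)"
    using mult_image_mono[of A "\<Union>\<C>"] \<open>A \<in> \<C>\<close> by blast
qed

lemma n_konvex_Int_convex:
  assumes "n_convex S add n A" and "n_konvex S add n B"
  shows "n_konvex S add n (A \<inter> B)"
  unfolding n_konvex_def
proof (intro conjI subsetI)
  show "y \<in> S" if "y \<in> A \<inter> B" for y
    using that assms(1) unfolding n_convex_def by blast
next
  fix s assume "s \<in> sumset add n (A \<inter> B)"
  then have sA: "s \<in> sumset add n A" and "s \<in> sumset add n B"
    using sumset_mono[of "A \<inter> B"] by blast+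
  then have "s \<in> mult_image add n B"
    using assms(2) unfolding n_konvex_def by blast
  then obtain b where "b \<in> B" and s: "s = mult add n b"
    unfolding mult_image_def by blast
  moreover have "b \<in> S"
    using \<open>b \<in> B\<close> assms(2) unfolding n_konvex_def by blast
  \<comment> \<open>The \<open>n\<close>-th part \<open>b\<close> found in \<open>B\<close> is forced into \<open>A\<close> by convexity.\<close>
  then have "b \<in> A"
    using sA s assms(1) unfolding n_convex_def mult_preimage_def by blast
  ultimately show "s \<in> mult_image add n (A \<inter> B)"
    unfolding mult_image_def by blast
qed

text \<open>All sums vanish except the doubles of the elements \<open>\<ge> 2\<close>, which equal \<open>1\<close>.  Since every sum is
  \<open>0\<close> or \<open>1\<close>, and adding anything to \<open>0\<close> or \<open>1\<close> gives \<open>0\<close>, every threefold sum is \<open>0\<close>; this is why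
  the operation is associative.\<close>

definition square_plus :: "nat \<Rightarrow> nat \<Rightarrow> nat" where
  "square_plus a b = (if a = b \<and> a \<ge> 2 then 1 else 0)"

lemma abelian_semigroup_square_plus: "abelian_semigroup UNIV square_plus"
proof
  fix a b c :: nat
  have "square_plus (square_plus a b) c = 0" and "square_plus a (square_plus b c) = 0"
    by (simp_all add: square_plus_def)
  then show "square_plus (square_plus a b) c = square_plus a (square_plus b c)"
    by simp
  show "square_plus a b = square_plus b a"
    by (simp add: square_plus_def)
qed simp

lemma sg_sum_two: "sg_sum add x 2 = add (x 1) (x 2)"
  by (simp add: numeral_2_eq_2)

lemma sumset_two: "sumset add 2 A = {add a b | a b. a \<in> A \<and> b \<in> A}"
proof (intro equalityI subsetI)
  fix s assume "s \<in> sumset add 2 A"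
  then obtain x where "s = add (x 1) (x 2)" and "\<forall>i\<in>{1..2::nat}. x i \<in> A"
    unfolding sumset_def sg_sum_two by blast
  moreover from this have "x 1 \<in> A" and "x 2 \<in> A"
    by simp_all
  ultimately show "s \<in> {add a b | a b. a \<in> A \<and> b \<in> A}"
    by blast
next
  fix s assume "s \<in> {add a b | a b. a \<in> A \<and> b \<in> A}"
  then obtain a b where "s = add a b" and "a \<in> A" and "b \<in> A"
    by blast
  then have "s = sg_sum add (\<lambda>i. if i = 1 then a else b) 2"
    and "\<forall>i\<in>{1..2::nat}. (if i = 1 then a else b) \<in> A"
    by (simp_all add: sg_sum_two)
  then show "s \<in> sumset add 2 A"
    unfolding sumset_def by (intro CollectI exI conjI)
qed

lemma mult_image_two: "mult_image add 2 A = (\<lambda>a. add a a) ` A"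
  unfolding mult_image_def mult_def sg_sum_two by blast

text \<open>The sum \<open>2 + 3 = 0\<close> has the half \<open>0\<close> in the first set and the half \<open>1\<close> in the second, while
  the only double of an element of \<open>{2, 3}\<close> is \<open>1\<close>.\<close>

lemma F_konvex_Int_counterexample:
  shows "F_konvex UNIV square_plus {2} {0, 2, 3}"
    and "F_konvex UNIV square_plus {2} {1, 2, 3}"
    and "\<not> F_konvex UNIV square_plus {2} ({0, 2, 3} \<inter> {1, 2, 3})"
proof -
  have "sumset square_plus 2 A \<subseteq> {0, 1}" for A
    unfolding sumset_two by (auto simp: square_plus_def)
  moreover have "mult_image square_plus 2 {0, 2, 3} = {0, 1}"
    and "mult_image square_plus 2 {1, 2, 3} = {0, 1}"
    by (auto simp: mult_image_two square_plus_def)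
  ultimately show "F_konvex UNIV square_plus {2} {0, 2, 3}"
    and "F_konvex UNIV square_plus {2} {1, 2, 3}"
    by (simp_all add: F_konvex_def n_konvex_def)
next
  have "square_plus 2 3 \<in> sumset square_plus 2 {2, 3}"
    unfolding sumset_two by blast
  then have "0 \<in> sumset square_plus 2 {2, 3}"
    by (simp add: square_plus_def)
  moreover have "0 \<notin> mult_image square_plus 2 {2, 3}"
    by (simp add: mult_image_two square_plus_def)
  moreover have "{0, 2, 3} \<inter> {1, 2, 3} = {2, 3 :: nat}"
    by auto
  ultimately show "\<not> F_konvex UNIV square_plus {2} ({0, 2, 3} \<inter> {1, 2, 3})"
    unfolding F_konvex_def n_konvex_def by auto
qed

theorem proposition5:
  fixes S :: "'a set" and add :: "'a \<Rightarrow> 'a \<Rightarrow> 'a" and F :: "nat set"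
  assumes "abelian_semigroup S add"
    and "F \<noteq> {}" and "F \<subseteq> {1..}"
  shows "((\<forall>\<A>. (\<forall>A\<in>\<A>. F_convex S add F A) \<longrightarrow> F_convex S add F (S \<inter> \<Inter>\<A>)) \<and>
          (\<forall>\<C>. chain_subset \<C> \<and> (\<forall>A\<in>\<C>. F_convex S add F A) \<longrightarrow> F_convex S add F (\<Union>\<C>))) \<and>
         (\<forall>\<C>. chain_subset \<C> \<and> (\<forall>A\<in>\<C>. F_konvex S add F A) \<longrightarrow> F_konvex S add F (\<Union>\<C>)) \<and>
         (\<exists>(T :: nat set) (plus :: nat \<Rightarrow> nat \<Rightarrow> nat) (G :: nat set) A B.
            abelian_semigroup T plus \<and> G \<noteq> {} \<and> G \<subseteq> {1..} \<and>
            F_konvex T plus G A \<and> F_konvex T plus G B \<and> \<not> F_konvex T plus G (A \<inter> B)) \<and>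
         ((\<forall>A B. F_convex S add F A \<and> F_konvex S add F B \<longrightarrow> F_konvex S add F (A \<inter> B)) \<and>
          (F_konvex S add F S \<longrightarrow> (\<forall>A. F_convex S add F A \<longrightarrow> F_konvex S add F A)))"
proof (intro conjI)
  have pos: "n \<ge> 1" if "n \<in> F" for n
    using that assms(3) by auto
  show "\<forall>\<A>. (\<forall>A\<in>\<A>. F_convex S add F A) \<longrightarrow> F_convex S add F (S \<inter> \<Inter>\<A>)"
    unfolding F_convex_def by (intro allI impI ballI n_convex_Inter) blast
  show "\<forall>\<C>. chain_subset \<C> \<and> (\<forall>A\<in>\<C>. F_convex S add F A) \<longrightarrow> F_convex S add F (\<Union>\<C>)"
    unfolding F_convex_def by (intro allI impI ballI n_convex_Union_chain pos) blast+
  show "\<forall>\<C>. chain_subset \<C> \<and> (\<forall>A\<in>\<C>. F_konvex S add F A) \<longrightarrow> F_konvex S add F (\<Union>\<C>)"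
    unfolding F_konvex_def by (intro allI impI ballI n_konvex_Union_chain pos) blast+
  show "\<exists>(T :: nat set) (plus :: nat \<Rightarrow> nat \<Rightarrow> nat) (G :: nat set) A B.
      abelian_semigroup T plus \<and> G \<noteq> {} \<and> G \<subseteq> {1..} \<and>
      F_konvex T plus G A \<and> F_konvex T plus G B \<and> \<not> F_konvex T plus G (A \<inter> B)"
    by (rule exI[of _ UNIV], rule exI[of _ square_plus], rule exI[of _ "{2}"],
        rule exI[of _ "{0, 2, 3}"], rule exI[of _ "{1, 2, 3}"])
      (intro conjI abelian_semigroup_square_plus F_konvex_Int_counterexample; simp)
  show Int: "\<forall>A B. F_convex S add F A \<and> F_konvex S add F B \<longrightarrow> F_konvex S add F (A \<inter> B)"
    unfolding F_convex_def F_konvex_def by (blast intro: n_konvex_Int_convex)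
  show "F_konvex S add F S \<longrightarrow> (\<forall>A. F_convex S add F A \<longrightarrow> F_konvex S add F A)"
  proof (intro impI allI)
    fix A assume "F_konvex S add F S" and "F_convex S add F A"
    then have "F_konvex S add F (A \<inter> S)"
      using Int by blast
    \<comment> \<open>Convex sets lie in \<open>S\<close> by definition, provided some index \<open>n \<in> F\<close> exists.\<close>
    moreover have "A \<subseteq> S"
      using \<open>F_convex S add F A\<close> assms(2) unfolding F_convex_def n_convex_def by blast
    ultimately show "F_konvex S add F A"
      by (simp add: Int_absorb2)
  qed
qed

end
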